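(* Let $D=\{(x_i,y_i):i\in[m]\}\subset\mathcal{X}\times\{+1,-1\}$ be an arbitrary dataset of size $m$ with positive label ratio $r>0$. For parameters $\nu,\mu$ such that $0<\mu<\nu<1$ and $\nu m,\mu m\in\mathbb{N}$, suppose that $\mu<r/2$ and $\nu-\mu<2(r-2\mu)$ hold. In addition, assume that the kernel function $k(x,x')$ of the RKHS $\mathcal{H}$ is bounded, i.e. $\sup_{x\in\mathcal{X}}k(x,x)<\infty$. Then $$\sup\{\,|b_{D'}|\,:\,D'\in\mathcal{D}_{\mu m}\,\}<\infty,$$ where $\mathcal{D}_{\mu m}$ is the family of contaminated datasets defined from $D$ and $b_{D'}$ is the bias parameter estimated by robust $(\nu,\mu)$-SVM from $D'$.
   Context: Let $\mathcal{X}$ be a (nonempty) input space and $\mathcal{H}$ a reproducing kernel Hilbert space (RKHS) of real functions on $\mathcal{X}$ with kernel $k:\mathcal{X}^2\to\mathbb{R}$ and norm $\|\cdot\|_{\mathcal{H}}$. Write $[m]=\{1,\ldots,m\}$ and $[z]_+=\max\{z,0\}$. A dataset of size $m$ is a collection $D=\{(x_i,y_i):i\in[m]\}$ of labeled points of $\mathcal{X}\times\{+1,-1\}$ (repetitions are allowed and counted with multiplicity). Its label ratio is $$r=\frac1m\min\{\,|\{i:y_i=+1\}|,\ |\{i:y_i=-1\}|\,\}.$$ For a dataset $D$ of size $m$ and an integer $0\le\kappa\le m$, the family of contaminated datasets is $$\mathcal{D}_\kappa=\{D'=\{(x_i',y_i'):i\in[m]\}\subset\mathcal{X}\times\{+1,-1\}\,:\,|D'\cap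 D|\ge m-\kappa\},$$ i.e. all datasets of size $m$ having at least $m-\kappa$ elements in common with $D$ (equivalently, obtained from $D$ by replacing at most $\kappa$ of its samples by arbitrary labeled points). Robust $(\nu,\mu)$-SVM applied to a dataset $D=\{(x_i,y_i):i\in[m]\}$ is the optimization problem $$\min_{f,b,\rho,\eta}\ \frac12\|f\|_{\mathcal{H}}^2-(\nu-\mu)\rho+\frac1m\sum_{i=1}^m\eta_i\big[\rho-y_i(f(x_i)+b)\big]_+$$ over $f\in\mathcal{H}$, $b,\rho\in\mathbb{R}$ and $\eta=(\eta_1,\ldots,\eta_m)^T\in E_\mu$, where $$E_\mu=\Big\{\eta\in\{0,1\}^m\,:\,\sum_{i=1}^m\eta_i\ge m(1-\mu)\Big\}.$$ The pair $(f_D,b_D)\in\mathcal{H}\times\mathbb{R}$ denotes the $(f,b)$-part of a (global) optimal solution; $b_D$ is the estimated bias parameter. If the optimal solution is not unique, $b_D$ is the bias of any choice of optimal solution. *)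

theory Defs
  imports Complex_Main "HOL-Library.Multiset"
begin

text \<open>
  The (nonempty) input space is the type \<open>'x\<close>. The inner product \<open>ip\<close> is only constrained on
  the carrier \<open>H\<close>; its values on functions outside \<open>H\<close> are irrelevant.
\<close>

definition rkhs_norm :: "(('x \<Rightarrow> real) \<Rightarrow> ('x \<Rightarrow> real) \<Rightarrow> real) \<Rightarrow> ('x \<Rightarrow> real) \<Rightarrow> real" where
  "rkhs_norm ip f = sqrt (ip f f)"

locale rkhs =
  fixes H :: "('x \<Rightarrow> real) set"
    and ip :: "('x \<Rightarrow> real) \<Rightarrow> ('x \<Rightarrow> real) \<Rightarrow> real"
    and k :: "'x \<Rightarrow> 'x \<Rightarrow> real"
  assumes zero_mem: "(\<lambda>x. 0) \<in> H"
    and add_mem: "\<lbrakk>f \<in> H; g \<in> H\<rbrakk> \<Longrightarrow> (\<lambda>x. f x + g x) \<in> H"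
    and scale_mem: "f \<in> H \<Longrightarrow> (\<lambda>x. c * f x) \<in> H"
    and ip_commute: "\<lbrakk>f \<in> H; g \<in> H\<rbrakk> \<Longrightarrow> ip f g = ip g f"
    and ip_add_left: "\<lbrakk>f \<in> H; g \<in> H; h \<in> H\<rbrakk> \<Longrightarrow> ip (\<lambda>x. f x + g x) h = ip f h + ip g h"
    and ip_scale_left: "\<lbrakk>f \<in> H; g \<in> H\<rbrakk> \<Longrightarrow> ip (\<lambda>x. c * f x) g = c * ip f g"
    and ip_nonneg: "f \<in> H \<Longrightarrow> ip f f \<ge> 0"
    and ip_definite: "\<lbrakk>f \<in> H; ip f f = 0\<rbrakk> \<Longrightarrow> f = (\<lambda>x. 0)"
    and complete:
      "\<lbrakk>\<And>n::nat. F n \<in> H;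
        \<And>e. e > 0 \<Longrightarrow> \<exists>N. \<forall>i\<ge>N. \<forall>j\<ge>N. rkhs_norm ip (\<lambda>x. F i x - F j x) < e\<rbrakk>
       \<Longrightarrow> \<exists>f\<in>H. (\<lambda>n. rkhs_norm ip (\<lambda>x. F n x - f x)) \<longlonglongrightarrow> 0"
    and kernel_mem: "(\<lambda>x. k x x') \<in> H"
    and reproducing: "f \<in> H \<Longrightarrow> f x' = ip f (\<lambda>x. k x x')"

text \<open>
  A dataset is an enumeration \<open>[(x\<^sub>1, y\<^sub>1), \<dots>, (x\<^sub>m, y\<^sub>m)]\<close> of its samples. The order is immaterial:
  intersections of datasets are taken between the underlying multisets.
\<close>

type_synonym 'x dataset = "('x \<times> real) list"

definition is_dataset :: "'x dataset \<Rightarrow> bool" where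
  "is_dataset D \<longleftrightarrow> (\<forall>(x, y) \<in> set D. y = 1 \<or> y = -1)"

definition label_ratio :: "'x dataset \<Rightarrow> real" where
  "label_ratio D =
     real (min (card {i. i < length D \<and> snd (D ! i) = 1})
               (card {i. i < length D \<and> snd (D ! i) = -1})) / real (length D)"

definition contaminated :: "'x dataset \<Rightarrow> nat \<Rightarrow> 'x dataset set" where
  "contaminated D \<kappa> =
     {D'. is_dataset D' \<and> length D' = length D \<and>
          size (mset D' \<inter># mset D) \<ge> length D - \<kappa>}"

definition eta_set :: "nat \<Rightarrow> real \<Rightarrow> real list set" where
  "eta_set m \<mu> =
     {\<eta>. length \<eta> = m \<and> set \<eta> \<subseteq> {0, 1} \<and> (\<Sum>i<m. \<eta> ! i) \<ge> real m * (1 - \<mu>)}"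

definition svm_objective ::
    "(('x \<Rightarrow> real) \<Rightarrow> ('x \<Rightarrow> real) \<Rightarrow> real) \<Rightarrow> real \<Rightarrow> real \<Rightarrow> 'x dataset
     \<Rightarrow> ('x \<Rightarrow> real) \<Rightarrow> real \<Rightarrow> real \<Rightarrow> real list \<Rightarrow> real" where
  "svm_objective ip \<nu> \<mu> D f b \<rho> \<eta> =
     1 / 2 * (rkhs_norm ip f)\<^sup>2 - (\<nu> - \<mu>) * \<rho>
     + 1 / real (length D) *
         (\<Sum>i<length D. \<eta> ! i * max (\<rho> - snd (D ! i) * (f (fst (D ! i)) + b)) 0)"

definition svm_optimal ::
    "('x \<Rightarrow> real) set \<Rightarrow> (('x \<Rightarrow> real) \<Rightarrow> ('x \<Rightarrow> real) \<Rightarrow> real) \<Rightarrow> real \<Rightarrow> real \<Rightarrow> 'x dataset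
     \<Rightarrow> ('x \<Rightarrow> real) \<Rightarrow> real \<Rightarrow> real \<Rightarrow> real list \<Rightarrow> bool" where
  "svm_optimal H ip \<nu> \<mu> D f b \<rho> \<eta> \<longleftrightarrow>
     f \<in> H \<and> \<eta> \<in> eta_set (length D) \<mu> \<and>
     (\<forall>f' \<in> H. \<forall>b' \<rho>'. \<forall>\<eta>' \<in> eta_set (length D) \<mu>.
        svm_objective ip \<nu> \<mu> D f b \<rho> \<eta> \<le> svm_objective ip \<nu> \<mu> D f' b' \<rho>' \<eta>')"

text \<open>Optimal solutions need not be unique, so the estimated bias is set-valued.\<close>

definition svm_biases ::
    "('x \<Rightarrow> real) set \<Rightarrow> (('x \<Rightarrow> real) \<Rightarrow> ('x \<Rightarrow> real) \<Rightarrow> real) \<Rightarrow> real \<Rightarrow> real \<Rightarrow> 'x dataset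
     \<Rightarrow> real set" where
  "svm_biases H ip \<nu> \<mu> D = {b. \<exists>f \<rho> \<eta>. svm_optimal H ip \<nu> \<mu> D f b \<rho> \<eta>}"

end

theory Submission imports Defs begin

text \<open>
  Only the comparison of an optimal solution with the zero solution is needed: the optimal value is
  at most 0. Let \<open>r\<close> be the label ratio of \<open>D\<close> and \<open>s = r - 2 \<mu>\<close>. After contamination and
  trimming by \<open>\<eta>\<close>, at least \<open>m s\<close> samples of each label remain active. If \<open>\<bar>f\<bar> \<le> B\<close>, these alone
  contribute \<open>s ([\<rho> - B - b]\<^sub>+ + [\<rho> - B + b]\<^sub>+)\<close> to the objective, which is at least both
  \<open>2 s (\<rho> - B)\<close> and \<open>s (\<rho> - B + \<bar>b\<bar>)\<close>. As \<open>\<nu> - \<mu> < 2 s\<close> and \<open>B\<close> is proportional to the norm of \<open>f\<close>,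
  the first bound confines \<open>f\<close> and \<open>\<rho>\<close>, and then the second one confines \<open>b\<close>.
\<close>

context rkhs
begin

lemma Cauchy_Schwarz:
  assumes f: "f \<in> H" and g: "g \<in> H"
  shows "(ip f g)\<^sup>2 \<le> ip f f * ip g g"
proof -
  have expand: "0 \<le> ip f f + 2 * t * ip f g + t\<^sup>2 * ip g g" for t
  proof -
    define h where "h = (\<lambda>x. t * g x)"
    have h: "h \<in> H"
      unfolding h_def by (rule scale_mem[OF g])
    have left: "ip h u = t * ip g u" if "u \<in> H" for u
      unfolding h_def by (rule ip_scale_left[OF g that])
    have fh: "(\<lambda>x. f x + h x) \<in> H"
      by (rule add_mem[OF f h])
    have "0 \<le> ip (\<lambda>x. f x + h x) (\<lambda>x. f x + h x)"
      by (rule ip_nonneg[OF fh])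
    also have "\<dots> = ip (\<lambda>x. f x + h x) f + ip (\<lambda>x. f x + h x) h"
      using ip_add_left[OF f h fh] ip_commute[OF f fh] ip_commute[OF h fh] by simp
    also have "\<dots> = ip f f + ip f h + (ip h f + ip h h)"
      using ip_add_left[OF f h f] ip_add_left[OF f h h] ip_commute[OF f h] by simp
    also have "\<dots> = ip f f + 2 * t * ip f g + t\<^sup>2 * ip g g"
      using left[OF f] left[OF g] left[OF h] ip_commute[OF f h] ip_commute[OF f g] ip_commute[OF g h]
      by (simp add: power2_eq_square)
    finally show ?thesis .
  qed
  show ?thesis
  proof (cases "ip g g = 0")
    case True
    \<comment> \<open>Writing the zero function as a multiple of \<open>g\<close> lets homogeneity
      of \<open>ip\<close> give \<open>ip g f = 0\<close>.\<close>
    then have "g = (\<lambda>x. 0 * g x)"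
      using ip_definite[OF g] by simp
    then have "ip g f = 0"
      using ip_scale_left[OF g f, of 0] by simp
    then show ?thesis
      using ip_commute[OF f g] True by simp
  next
    case False
    then have pos: "ip g g > 0"
      using ip_nonneg[OF g] by simp
    \<comment> \<open>The chosen \<open>t\<close> minimises the quadratic in
      \<open>expand\<close>.\<close>
    have "0 \<le> ip f f - (ip f g)\<^sup>2 / ip g g"
      using expand[of "- ip f g / ip g g"] pos by (simp add: power2_eq_square)
    then show ?thesis
      using pos by (simp add: field_simps)
  qed
qed

text \<open>Evaluation at \<open>x\<close> is the inner product with the kernel section at
  \<open>x\<close>, whose squared norm is \<open>k x x\<close> by the reproducing property. A
  bounded kernel thus turns a norm bound into a uniform bound on values.\<close>

lemma abs_eval_le:
  assumes f: "f \<in> H" and K: "k x x \<le> K"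
  shows "\<bar>f x\<bar> \<le> rkhs_norm ip f * sqrt K"
proof -
  have "(f x)\<^sup>2 \<le> ip f f * k x x"
    using Cauchy_Schwarz[OF f kernel_mem[of x]] reproducing[OF f, of x]
      reproducing[OF kernel_mem[of x], of x] by simp
  also have "\<dots> \<le> ip f f * K"
    using K ip_nonneg[OF f] by (rule mult_left_mono)
  finally have "sqrt ((f x)\<^sup>2) \<le> sqrt (ip f f * K)"
    by (rule real_sqrt_le_mono)
  then show ?thesis
    by (simp add: rkhs_norm_def real_sqrt_mult)
qed

lemma svm_objective_zero [simp]: "svm_objective ip \<nu> \<mu> D (\<lambda>x. 0) 0 0 \<eta> = 0"
proof -
  have "ip (\<lambda>x. 0) (\<lambda>x. 0) = 0"
    using ip_scale_left[OF zero_mem zero_mem, of 0] by simp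
  then show ?thesis
    by (simp add: svm_objective_def rkhs_norm_def)
qed

lemma svm_optimal_nonpos:
  assumes "svm_optimal H ip \<nu> \<mu> D f b \<rho> \<eta>"
  shows "svm_objective ip \<nu> \<mu> D f b \<rho> \<eta> \<le> 0"
proof -
  \<comment> \<open>The competitor keeps the optimal \<open>\<eta>\<close>, so its feasibility comes
    for free.\<close>
  have "svm_objective ip \<nu> \<mu> D f b \<rho> \<eta> \<le> svm_objective ip \<nu> \<mu> D (\<lambda>x. 0) 0 0 \<eta>"
    using assms zero_mem unfolding svm_optimal_def by blast
  then show ?thesis
    by simp
qed

end

text \<open>Split \<open>D\<close> into the part shared with \<open>D'\<close> and a remainder of at
  most \<open>\<kappa>\<close> samples: the shared part is counted in \<open>D'\<close> as well, and
  the remainder costs at most \<open>\<kappa>\<close>.\<close>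

lemma contaminated_label_count:
  assumes "D' \<in> contaminated D \<kappa>"
  shows "card {i. i < length D \<and> snd (D ! i) = y}
    \<le> card {i. i < length D' \<and> snd (D' ! i) = y} + \<kappa>"
proof -
  let ?P = "\<lambda>p. snd p = y"
  have count: "card {i. i < length E \<and> snd (E ! i) = y} = size (filter_mset ?P (mset E))"
    for E :: "'a dataset"
    by (simp add: length_filter_conv_card flip: mset_filter)
  let ?I = "mset D' \<inter># mset D"
  have split: "mset D = ?I + (mset D - ?I)"
    by (rule subset_mset.add_diff_inverse[symmetric]) simp
  have "length D = size ?I + size (mset D - ?I)"
    using arg_cong[OF split, of size] by (simp only: size_union size_mset)
  moreover have "length D - \<kappa> \<le> size ?I"
    using assms unfolding contaminated_def by blast
  ultimately have rest: "size (mset D - ?I) \<le> \<kappa>"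
    by linarith
  have "size (filter_mset ?P (mset D))
      = size (filter_mset ?P ?I) + size (filter_mset ?P (mset D - ?I))"
    by (subst split) (simp only: filter_union_mset size_union)
  also have "size (filter_mset ?P ?I) \<le> size (filter_mset ?P (mset D'))"
    by (rule size_mset_mono[OF multiset_filter_mono]) simp
  also have "size (filter_mset ?P (mset D - ?I)) \<le> \<kappa>"
    using size_filter_mset_lesseq rest by (rule order_trans)
  finally show ?thesis
    by (simp add: count)
qed

lemma eta_set_nth:
  assumes "\<eta> \<in> eta_set m \<mu>" "i < m"
  shows "\<eta> ! i = 0 \<or> \<eta> ! i = 1"
  using assms nth_mem unfolding eta_set_def by blast

text \<open>For 0/1 weights the sum is \<open>m\<close> minus the number of zeros, so its lower
  bound caps the number of trimmed samples.\<close>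

lemma eta_set_card_zeros:
  assumes \<eta>: "\<eta> \<in> eta_set m \<mu>" and \<kappa>: "\<mu> * real m = real \<kappa>"
  shows "card {i. i < m \<and> \<eta> ! i = 0} \<le> \<kappa>"
proof -
  have "(\<Sum>i<m. \<eta> ! i) = (\<Sum>i<m. 1 - of_bool (\<eta> ! i = 0))"
    using eta_set_nth[OF \<eta>] by (intro sum.cong) auto
  also have "\<dots> = real m - real (card {i. i < m \<and> \<eta> ! i = 0})"
    by (simp add: sum_subtractf of_bool_def sum.If_cases Int_def conj_commute lessThan_def)
  finally show ?thesis
    using \<eta> \<kappa> by (simp add: eta_set_def algebra_simps)
qed

text \<open>Trimming removes at most \<open>\<kappa>\<close> samples of label \<open>y\<close>, so
  at least \<open>n\<close> keep weight 1. Each of these has hinge loss at least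
  \<open>max (\<rho> - B - y * b) 0\<close>, because \<open>y * f x \<le> B\<close>.\<close>

lemma hinge_sum_label_ge:
  assumes \<eta>: "\<eta> \<in> eta_set (length D) \<mu>"
    and \<kappa>: "\<mu> * real (length D) = real \<kappa>"
    and B: "\<And>x. \<bar>f x\<bar> \<le> B"
    and y: "\<bar>y\<bar> = 1"
    and n: "n + real \<kappa> \<le> real (card {i. i < length D \<and> snd (D ! i) = y})"
  shows "n * max (\<rho> - B - y * b) 0
    \<le> (\<Sum>i | i < length D \<and> snd (D ! i) = y.
          \<eta> ! i * max (\<rho> - snd (D ! i) * (f (fst (D ! i)) + b)) 0)"
proof -
  let ?I = "{i. i < length D \<and> snd (D ! i) = y}"
  let ?Z = "{i. i < length D \<and> \<eta> ! i = 0}"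
  let ?c = "max (\<rho> - B - y * b) 0"
  let ?h = "\<lambda>i. \<eta> ! i * max (\<rho> - snd (D ! i) * (f (fst (D ! i)) + b)) 0"
  have "card ?I - card ?Z \<le> card (?I - ?Z)"
    by (rule diff_card_le_card_Diff) simp
  then have "n \<le> real (card (?I - ?Z))"
    using n eta_set_card_zeros[OF \<eta> \<kappa>] by linarith
  then have "n * ?c \<le> real (card (?I - ?Z)) * ?c"
    by (rule mult_right_mono) simp
  also have "\<dots> = (\<Sum>i\<in>?I - ?Z. ?c)"
    by simp
  also have "\<dots> \<le> (\<Sum>i\<in>?I - ?Z. ?h i)"
  proof (rule sum_mono)
    fix i assume i: "i \<in> ?I - ?Z"
    then have "\<eta> ! i = 1"
      using eta_set_nth[OF \<eta>, of i] by auto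
    moreover have "y * f (fst (D ! i)) \<le> B"
      using B[of "fst (D ! i)"] y abs_mult[of y "f (fst (D ! i))"] by simp
    ultimately show "?c \<le> ?h i"
      using i by (auto simp: distrib_left)
  qed
  \<comment> \<open>The terms added back have weight 0.\<close>
  also have "\<dots> \<le> (\<Sum>i\<in>?I. ?h i)"
  proof (rule sum_mono2)
    fix i assume "i \<in> ?I - (?I - ?Z)"
    then show "0 \<le> ?h i"
      by auto
  qed auto
  finally show ?thesis .
qed

text \<open>The loss splits over the two labels, and each class is bounded with
  \<open>n = s * m\<close>, so the factor \<open>1 / m\<close> cancels. The spare
  \<open>\<kappa>\<close> in the counts pays for trimming.\<close>

lemma svm_objective_ge:
  assumes D: "is_dataset D" "D \<noteq> []"
    and \<eta>: "\<eta> \<in> eta_set (length D) \<mu>"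
    and \<kappa>: "\<mu> * real (length D) = real \<kappa>"
    and B: "\<And>x. \<bar>f x\<bar> \<le> B"
    and pos: "s * real (length D) + real \<kappa> \<le> real (card {i. i < length D \<and> snd (D ! i) = 1})"
    and neg: "s * real (length D) + real \<kappa> \<le> real (card {i. i < length D \<and> snd (D ! i) = -1})"
  shows "1 / 2 * (rkhs_norm ip f)\<^sup>2 - (\<nu> - \<mu>) * \<rho>
      + s * (max (\<rho> - B - b) 0 + max (\<rho> - B + b) 0) \<le> svm_objective ip \<nu> \<mu> D f b \<rho> \<eta>"
proof -
  let ?m = "real (length D)"
  let ?I = "\<lambda>y. {i. i < length D \<and> snd (D ! i) = y}"
  let ?h = "\<lambda>i. \<eta> ! i * max (\<rho> - snd (D ! i) * (f (fst (D ! i)) + b)) 0"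
  have m: "?m > 0"
    using D by simp
  have labels: "snd (D ! i) = 1 \<or> snd (D ! i) = -1" if "i < length D" for i
    using D(1) nth_mem[OF that] unfolding is_dataset_def by (auto simp: case_prod_beta)
  have "?m * (s * (max (\<rho> - B - b) 0 + max (\<rho> - B + b) 0))
      = s * ?m * max (\<rho> - B - 1 * b) 0 + s * ?m * max (\<rho> - B - (-1) * b) 0"
    by (simp add: algebra_simps)
  also have "\<dots> \<le> sum ?h (?I 1) + sum ?h (?I (-1))"
    by (intro add_mono hinge_sum_label_ge[OF \<eta> \<kappa> B] pos neg) simp_all
  also have "\<dots> = sum ?h (?I 1 \<union> ?I (-1))"
    by (rule sum.union_disjoint[symmetric]) auto
  also have "?I 1 \<union> ?I (-1) = {..<length D}"
    using labels by auto
  finally have "s * (max (\<rho> - B - b) 0 + max (\<rho> - B + b) 0) \<le> 1 / ?m * sum ?h {..<length D}"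
    using m by (simp add: field_simps)
  then show ?thesis
    by (simp add: svm_objective_def)
qed

text \<open>Here \<open>n\<close> stands for the norm of \<open>f\<close>, \<open>C\<close> for the
  square root of the kernel bound and \<open>c\<close> for \<open>\<nu> - \<mu>\<close>. The final
  bound is free of \<open>n\<close> and \<open>\<rho>\<close>, hence uniform over datasets.\<close>

lemma bias_bound:
  fixes n C \<rho> b c s :: real
  assumes s: "0 < s" and c: "0 < c" "c < 2 * s" and n: "0 \<le> n" and C: "0 \<le> C"
    and le: "1 / 2 * n\<^sup>2 - c * \<rho> + s * (max (\<rho> - n * C - b) 0 + max (\<rho> - n * C + b) 0) \<le> 0"
  shows "\<bar>b\<bar> \<le> c * (2 * s * (4 * s * C * C) / (2 * s - c)) / s + 4 * s * C * C"
proof -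
  let ?B = "n * C"
  let ?S = "max (\<rho> - ?B - b) 0 + max (\<rho> - ?B + b) 0"
  \<comment> \<open>The sign of \<open>\<rho>\<close> serves twice: to drop
    \<open>(2 * s - c) * \<rho>\<close> when bounding \<open>n\<close>, and to drop
    \<open>\<rho>\<close> when isolating \<open>\<bar>b\<bar>\<close>.\<close>
  have "0 \<le> s * ?S"
    using s by simp
  then have "0 \<le> c * \<rho>"
    using le zero_le_power2[of n] by linarith
  then have \<rho>: "0 \<le> \<rho>"
    using c by (simp add: zero_le_mult_iff)
  \<comment> \<open>The two hinge arguments add up to an expression without
    \<open>b\<close>.\<close>
  have "s * (2 * (\<rho> - ?B)) \<le> s * ?S"
    using s by (intro mult_left_mono) auto
  then have key: "(2 * s - c) * \<rho> + 1 / 2 * n\<^sup>2 \<le> 2 * s * ?B"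
    using le by (simp add: algebra_simps)
  have "0 \<le> (2 * s - c) * \<rho>"
    using c \<rho> by simp
  then have "n * n \<le> n * (4 * s * C)"
    using key by (simp add: power2_eq_square algebra_simps)
  then have "n \<le> 4 * s * C"
    using n s C by (cases "n = 0") auto
  then have B: "?B \<le> 4 * s * C * C"
    using C by (rule mult_right_mono)
  have "(2 * s - c) * \<rho> \<le> 2 * s * ?B"
    using key zero_le_power2[of n] by linarith
  also have "\<dots> \<le> 2 * s * (4 * s * C * C)"
    using B s by (intro mult_left_mono) auto
  finally have \<rho>_le: "\<rho> \<le> 2 * s * (4 * s * C * C) / (2 * s - c)"
    using c by (simp add: pos_le_divide_eq mult.commute)
  \<comment> \<open>Only the hinge in which \<open>b\<close> enters as \<open>\<bar>b\<bar>\<close>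
    is kept; the other is nonnegative.\<close>
  have "s * (\<rho> - ?B + \<bar>b\<bar>) \<le> s * ?S"
    using s by (intro mult_left_mono) auto
  then have "s * (\<rho> - ?B + \<bar>b\<bar>) \<le> c * \<rho>"
    using le zero_le_power2[of n] by linarith
  then have "\<rho> - ?B + \<bar>b\<bar> \<le> c * \<rho> / s"
    using s by (simp add: pos_le_divide_eq mult.commute)
  moreover have "c * \<rho> / s \<le> c * (2 * s * (4 * s * C * C) / (2 * s - c)) / s"
    using c s \<rho>_le by (intro divide_right_mono mult_left_mono) auto
  ultimately show ?thesis
    using \<rho> B by linarith
qed

theorem theorem4:
  fixes H :: "('x \<Rightarrow> real) set"
    and ip :: "('x \<Rightarrow> real) \<Rightarrow> ('x \<Rightarrow> real) \<Rightarrow> real"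
    and k :: "'x \<Rightarrow> 'x \<Rightarrow> real"
    and D :: "'x dataset"
    and \<nu> \<mu> :: real
    and \<kappa> :: nat
  assumes "rkhs H ip k"
    and "is_dataset D"
    and "label_ratio D > 0"
    and "0 < \<mu>" and "\<mu> < \<nu>" and "\<nu> < 1"
    and "\<nu> * real (length D) \<in> \<nat>"
    and "\<mu> * real (length D) = real \<kappa>"
    and "\<mu> < label_ratio D / 2"
    and "\<nu> - \<mu> < 2 * (label_ratio D - 2 * \<mu>)"
    and "bdd_above (range (\<lambda>x. k x x))"
  shows "bdd_above {\<bar>b\<bar> | b D'. D' \<in> contaminated D \<kappa> \<and> b \<in> svm_biases H ip \<nu> \<mu> D'}"
proof -
  interpret rkhs H ip k by fact
  define s where "s = label_ratio D - 2 * \<mu>"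
  obtain K where K: "\<And>x. k x x \<le> K"
    using assms(11) by (auto simp: bdd_above_def)
  \<comment> \<open>The point \<open>undefined\<close> is just some element of the nonempty input
    space.\<close>
  have "0 \<le> ip (\<lambda>x. k x undefined) (\<lambda>x. k x undefined)"
    by (rule ip_nonneg[OF kernel_mem])
  then have "0 \<le> k undefined undefined"
    using reproducing[OF kernel_mem] by metis
  then have K_nonneg: "0 \<le> K"
    using K[of undefined] by linarith
  \<comment> \<open>For empty \<open>D\<close> the label ratio would be a division by 0, which has
    value 0.\<close>
  have m: "length D > 0"
    using assms(3) by (auto simp: label_ratio_def)
  have s: "0 < s" "\<nu> - \<mu> < 2 * s"
    using assms(9,10) by (simp_all add: s_def)
  \<comment> \<open>One \<open>\<kappa>\<close> is spent on contamination, the other on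
    trimming.\<close>
  have ratio: "s * real (length D) + 2 * real \<kappa> \<le> real (card {i. i < length D \<and> snd (D ! i) = y})"
    if "y = 1 \<or> y = -1" for y
  proof -
    have "s * real (length D) + 2 * real \<kappa> = label_ratio D * real (length D)"
      by (simp add: s_def assms(8)[symmetric] algebra_simps)
    also have "\<dots> \<le> real (card {i. i < length D \<and> snd (D ! i) = y})"
      using that m by (auto simp: label_ratio_def)
    finally show ?thesis .
  qed
  let ?C = "sqrt K"
  let ?M = "(\<nu> - \<mu>) * (2 * s * (4 * s * ?C * ?C) / (2 * s - (\<nu> - \<mu>))) / s + 4 * s * ?C * ?C"
  have "\<bar>b\<bar> \<le> ?M" if D': "D' \<in> contaminated D \<kappa>" and b: "b \<in> svm_biases H ip \<nu> \<mu> D'" for b D'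
  proof -
    obtain f \<rho> \<eta> where opt: "svm_optimal H ip \<nu> \<mu> D' f b \<rho> \<eta>"
      using b by (auto simp: svm_biases_def)
    then have f: "f \<in> H" and \<eta>: "\<eta> \<in> eta_set (length D') \<mu>"
      by (auto simp: svm_optimal_def)
    have data: "is_dataset D'" and len: "length D' = length D"
      using D' by (auto simp: contaminated_def)
    then have ne: "D' \<noteq> []" and \<kappa>: "\<mu> * real (length D') = real \<kappa>"
      using m assms(8) by auto
    have counts: "s * real (length D') + real \<kappa> \<le> real (card {i. i < length D' \<and> snd (D' ! i) = y})"
      if "y = 1 \<or> y = -1" for y
      using ratio[OF that] contaminated_label_count[OF D', of y] len by simp
    have "1 / 2 * (rkhs_norm ip f)\<^sup>2 - (\<nu> - \<mu>) * \<rho>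
        + s * (max (\<rho> - rkhs_norm ip f * ?C - b) 0 + max (\<rho> - rkhs_norm ip f * ?C + b) 0)
      \<le> svm_objective ip \<nu> \<mu> D' f b \<rho> \<eta>"
      using abs_eval_le[OF f K] counts by (intro svm_objective_ge[OF data ne \<eta> \<kappa>]) simp_all
    also have "\<dots> \<le> 0"
      by (rule svm_optimal_nonpos[OF opt])
    finally show ?thesis
      using s assms(5) K_nonneg ip_nonneg[OF f] 
      by (intro bias_bound[where n = "rkhs_norm ip f" and \<rho> = \<rho>]) (simp_all add: rkhs_norm_def)
  qed
  then show ?thesis
    by (auto intro!: bdd_aboveI[where M = ?M])
qed

end
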